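(* Let $\{X^{s,t}\}$ be a scale of seminormed function spaces on $\mathbb{R}^n$, indexed by pairs of exponents $(s,t)$, let $Z\subset\bigcap_{s,t}X^{s,t}$ be a common subset such that every $f\in Z$ satisfies $|\operatorname{supp}(f)|<\infty$, and let $Y^{s,t}$ denote the closure of $Z$ in $X^{s,t}$. Fix $p,q\in(0,\infty)$ (with $(p,q)$ among the indices). Let $T$ be a linear operator for which there is a constant $C<\infty$ such that $$\|[f,T]\|_{L^p\to L^q}\le C\,\|f\|_{X^{p,q}}\qquad\text{for all } f\in X^{p,q},$$ and suppose that there exist exponents $e\in[q,\infty]$ and $u\in(0,p]$ such that $$[f,T]\in\mathcal{K}(L^p,L^e)\cap\mathcal{K}(L^u,L^q)\qquad\text{for all } f\in Z.$$ Then $[b,T]\in\mathcal{K}(L^p,L^q)$ for every $b\in Y^{p,q}$.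
   Context: Functions are measurable functions $\mathbb{R}^n\to\mathbb{C}$, $L^p=L^p(\mathbb{R}^n)$ with respect to Lebesgue measure (a quasi-Banach space when $p<1$), and $|E|$ denotes the Lebesgue measure of a set $E$. Each $X^{s,t}$ is a vector space of functions equipped with a seminorm $\|\cdot\|_{X^{s,t}}$; the set $Z$ is not required to have any further structure. A function $b$ lies in $Y^{s,t}$ if $b\in X^{s,t}$ and for every $\varepsilon>0$ there is $f\in Z$ with $\|b-f\|_{X^{s,t}}<\varepsilon$. For a function $b$ and a linear operator $T$ (mapping functions to functions), the commutator is the linear operator $[b,T]g:=bTg-T(bg)$. It is part of the hypotheses that the commutators appearing in them are well defined by this formula on the Lebesgue spaces indicated, with a single operator $T$ giving the action on all of these spaces. $\|[b,T]\|_{L^p\to L^q}$ is the operator (quasi-)norm, and $\mathcal{K}(A,B)$ denotes the class of compact linear operators from $A$ to $B$. *)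

theory Defs
  imports "HOL-Analysis.Analysis" "HOL-Probability.Essential_Supremum"
begin

type_synonym 'n cfun = "real ^ 'n \<Rightarrow> complex"

text \<open>
  Functions are not divided out by equality almost everywhere; instead, all notions below that
  concern \<open>L\<^sup>p\<close> are formulated so as to be insensitive to changes on null sets.
  Exponents are of type \<^typ>\<open>ennreal\<close>.
\<close>

text \<open>
  The case distinction on the integral is needed since \<open>powr\<close> is not available on
  \<^typ>\<open>ennreal\<close>. Only exponents \<open>r > 0\<close> are meaningful.
\<close>

definition Lp_norm :: "ennreal \<Rightarrow> 'n::finite cfun \<Rightarrow> ennreal" where
  "Lp_norm r f =
    (if r = \<infinity> then esssup lebesgue (\<lambda>x. ennreal (cmod (f x)))
     else let I = (\<integral>\<^sup>+ x. ennreal (cmod (f x) powr enn2real r) \<partial>lebesgue)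
          in if I = \<infinity> then \<infinity> else ennreal (enn2real I powr (1 / enn2real r)))"

definition Lp :: "ennreal \<Rightarrow> 'n::finite cfun set" where
  "Lp r = {f \<in> borel_measurable lebesgue. Lp_norm r f < \<infinity>}"

definition cfun_subspace :: "'n::finite cfun set \<Rightarrow> bool" where
  "cfun_subspace V \<longleftrightarrow>
     V \<subseteq> borel_measurable lebesgue \<and> (\<lambda>x. 0) \<in> V \<and>
     (\<forall>f\<in>V. \<forall>g\<in>V. (\<lambda>x. f x + g x) \<in> V) \<and>
     (\<forall>c. \<forall>f\<in>V. (\<lambda>x. c * f x) \<in> V)"

definition seminormed_cfun_space :: "'n::finite cfun set \<Rightarrow> ('n cfun \<Rightarrow> real) \<Rightarrow> bool" where
  "seminormed_cfun_space X N \<longleftrightarrow>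
     cfun_subspace X \<and>
     (\<forall>f\<in>X. 0 \<le> N f) \<and>
     (\<forall>f\<in>X. \<forall>g\<in>X. N (\<lambda>x. f x + g x) \<le> N f + N g) \<and>
     (\<forall>c. \<forall>f\<in>X. N (\<lambda>x. c * f x) = cmod c * N f)"

definition seminorm_closure ::
  "'n::finite cfun set \<Rightarrow> ('n cfun \<Rightarrow> real) \<Rightarrow> 'n cfun set \<Rightarrow> 'n cfun set" where
  "seminorm_closure X N Z = {b \<in> X. \<forall>\<epsilon>>0. \<exists>f\<in>Z. N (\<lambda>x. b x - f x) < \<epsilon>}"

text \<open>Linearity of the map that \<open>A\<close> induces on the classes modulo null sets of functions in \<open>V\<close>.\<close>

definition linear_AE_on :: "'n::finite cfun set \<Rightarrow> ('n cfun \<Rightarrow> 'n cfun) \<Rightarrow> bool" where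
  "linear_AE_on V A \<longleftrightarrow>
     (\<forall>g\<in>V. A g \<in> borel_measurable lebesgue) \<and>
     (\<forall>g\<in>V. \<forall>h\<in>V. (AE x in lebesgue. g x = h x) \<longrightarrow> (AE x in lebesgue. A g x = A h x)) \<and>
     (\<forall>g\<in>V. \<forall>h\<in>V. AE x in lebesgue. A (\<lambda>y. g y + h y) x = A g x + A h x) \<and>
     (\<forall>c. \<forall>g\<in>V. AE x in lebesgue. A (\<lambda>y. c * g y) x = c * A g x)"

text \<open>
  A linear operator taking measurable functions to measurable functions, with a domain \<open>D\<close> that
  need not contain all measurable functions. Values outside \<open>D\<close> carry no meaning.
\<close>

definition linear_operator :: "'n::finite cfun set \<Rightarrow> ('n cfun \<Rightarrow> 'n cfun) \<Rightarrow> bool" where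
  "linear_operator D T \<longleftrightarrow>
     cfun_subspace D \<and>
     (\<forall>g\<in>D. \<forall>h \<in> borel_measurable lebesgue. (AE x in lebesgue. g x = h x) \<longrightarrow> h \<in> D) \<and>
     linear_AE_on D T"

definition commutator ::
  "'n::finite cfun \<Rightarrow> ('n cfun \<Rightarrow> 'n cfun) \<Rightarrow> 'n cfun \<Rightarrow> 'n cfun" where
  "commutator b T g = (\<lambda>x. b x * T g x - T (\<lambda>y. b y * g y) x)"

definition commutator_dom :: "'n::finite cfun \<Rightarrow> 'n cfun set \<Rightarrow> 'n cfun set" where
  "commutator_dom b D = {g \<in> D. (\<lambda>x. b x * g x) \<in> D}"

definition op_norm ::
  "ennreal \<Rightarrow> ennreal \<Rightarrow> ('n::finite cfun \<Rightarrow> 'n cfun) \<Rightarrow> ennreal" where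
  "op_norm r s A = (SUP g \<in> {g \<in> Lp r. Lp_norm r g \<le> 1}. Lp_norm s (A g))"

text \<open>
  Compact linear operators from \<open>L\<^sup>r\<close> to \<open>L\<^sup>s\<close>: every bounded sequence has a subsequence whose
  images converge in \<open>L\<^sup>s\<close>.
\<close>

definition compact_operators ::
  "ennreal \<Rightarrow> ennreal \<Rightarrow> ('n::finite cfun \<Rightarrow> 'n cfun) set" where
  "compact_operators r s =
    {A. linear_AE_on (Lp r) A \<and> A ` Lp r \<subseteq> Lp s \<and>
        (\<forall>G :: nat \<Rightarrow> 'n cfun. range G \<subseteq> Lp r \<and> (\<exists>M<\<infinity>. \<forall>k. Lp_norm r (G k) \<le> M) \<longrightarrow>
          (\<exists>h \<in> Lp s. \<exists>\<rho> :: nat \<Rightarrow> nat. strict_mono \<rho> \<and>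
             (\<lambda>k. Lp_norm s (\<lambda>x. A (G (\<rho> k)) x - h x)) \<longlonglongrightarrow> 0))}"

end

theory Submission
  imports Defs "HOL-Library.Diagonal_Subsequence"
begin

text \<open>
  For \<open>f \<in> Z\<close> with support \<open>E\<close> we have \<open>[f,T]g = 1\<^bsub>E\<^esub> [f,T]g + 1\<^bsub>-E\<^esub> [f,T](1\<^bsub>E\<^esub> g)\<close>, because off \<open>E\<close> only the
  term \<open>-T(fg)\<close> survives and \<open>fg = f 1\<^bsub>E\<^esub> g\<close>. As \<open>|E| < \<infinity>\<close>, restriction to \<open>E\<close> maps \<open>L\<^sup>e\<close> to \<open>L\<^sup>q\<close>
  and \<open>L\<^sup>p\<close> to \<open>L\<^sup>u\<close> continuously, so both terms are compact from \<open>L\<^sup>p\<close> to \<open>L\<^sup>q\<close>. For general \<open>b\<close>,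
  \<open>[b,T] - [f,T] = [b - f,T]\<close> has small norm, and a norm limit of compact operators is compact by
  a diagonal argument and the completeness of \<open>L\<^sup>q\<close>, which is needed here also for \<open>q < 1\<close>.
\<close>

subsection \<open>The integral of a power of the modulus\<close>

text \<open>For a finite exponent, the \<open>r\<close>-th power of the \<open>L^r\<close>
  quasi-norm. Working without the root keeps the estimates additive under integration and treats
  \<open>r < 1\<close> and \<open>r \<ge> 1\<close> alike.\<close>

definition Lp_int :: "real \<Rightarrow> 'n::finite cfun \<Rightarrow> ennreal" where
  "Lp_int r f = (\<integral>\<^sup>+ x. ennreal (cmod (f x) powr r) \<partial>lebesgue)"

lemma Lp_int_cong_AE:
  "AE x in lebesgue. f x = g x \<Longrightarrow> Lp_int r f = Lp_int r g"
  unfolding Lp_int_def by (rule nn_integral_cong_AE) auto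

lemma Lp_int_scale:
  assumes [measurable]: "f \<in> borel_measurable lebesgue"
  shows "Lp_int r (\<lambda>x. c * f x) = ennreal (cmod c powr r) * Lp_int r f"
  unfolding Lp_int_def
  by (simp add: norm_mult powr_mult ennreal_mult nn_integral_cmult)

text \<open>Bounding \<open>|a + b|\<close> by twice the larger modulus works for every positive
  exponent, whereas a convexity argument would require \<open>r \<ge> 1\<close>.\<close>

lemma cmod_add_powr_le:
  assumes "0 < r"
  shows "cmod (a + b) powr r \<le> 2 powr r * (cmod a powr r + cmod b powr r)"
proof -
  have "cmod (a + b) powr r \<le> (2 * max (cmod a) (cmod b)) powr r"
    using assms norm_triangle_ineq[of a b] by (intro powr_mono2) auto
  also have "\<dots> = 2 powr r * max (cmod a) (cmod b) powr r"
    by (simp add: powr_mult)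
  also have "\<dots> \<le> 2 powr r * (cmod a powr r + cmod b powr r)"
    by (intro mult_left_mono) (auto simp: max_def)
  finally show ?thesis .
qed

lemma Lp_int_add_le:
  assumes [measurable]: "f \<in> borel_measurable lebesgue" "g \<in> borel_measurable lebesgue" and "0 < r"
  shows "Lp_int r (\<lambda>x. f x + g x) \<le> ennreal (2 powr r) * (Lp_int r f + Lp_int r g)"
proof -
  have "Lp_int r (\<lambda>x. f x + g x) \<le>
      (\<integral>\<^sup>+ x. ennreal (2 powr r) * (ennreal (cmod (f x) powr r) + ennreal (cmod (g x) powr r)) \<partial>lebesgue)"
    unfolding Lp_int_def using cmod_add_powr_le[OF \<open>0 < r\<close>]
    by (intro nn_integral_mono) (simp flip: ennreal_plus ennreal_mult)
  also have "\<dots> = ennreal (2 powr r) * (Lp_int r f + Lp_int r g)"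
    unfolding Lp_int_def by (simp add: nn_integral_cmult nn_integral_add)
  finally show ?thesis .
qed

lemma Lp_int_minus_commute: "Lp_int r (\<lambda>x. f x - g x) = Lp_int r (\<lambda>x. g x - f x)"
  unfolding Lp_int_def by (simp add: norm_minus_commute)

lemma Lp_int_triangle:
  assumes [measurable]: "f \<in> borel_measurable lebesgue" "g \<in> borel_measurable lebesgue"
      "h \<in> borel_measurable lebesgue" and "0 < r"
  shows "Lp_int r (\<lambda>x. f x - h x) \<le>
    ennreal (2 powr r) * (Lp_int r (\<lambda>x. f x - g x) + Lp_int r (\<lambda>x. g x - h x))"
  using Lp_int_add_le[of "\<lambda>x. f x - g x" "\<lambda>x. g x - h x" r] assms by simp

section \<open>Passage between the quasi-norm and the integral\<close>

lemma enn2real_exponent_pos: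
  "0 < p \<Longrightarrow> p < \<infinity> \<Longrightarrow> 0 < enn2real p"
  by (simp add: enn2real_positive_iff less_top)

text \<open>Taking powers with a positive exponent preserves the order of nonnegative reals, and an
  infinite integral makes both sides false. This carries real bounds between \<open>Lp_norm\<close>
  and \<open>Lp_int\<close>.\<close>

lemma Lp_norm_le_iff:
  assumes "0 < p" "p < \<infinity>" "0 \<le> K"
  shows "Lp_norm p f \<le> ennreal K \<longleftrightarrow> Lp_int (enn2real p) f \<le> ennreal (K powr enn2real p)"
proof (cases "Lp_int (enn2real p) f")
  case (real a)
  have r: "0 < enn2real p" using assms by (simp add: enn2real_exponent_pos)
  have "a powr (1 / enn2real p) \<le> K \<longleftrightarrow> a \<le> K powr enn2real p"
  proof -
    have "a powr (1 / enn2real p) \<le> K \<longleftrightarrow>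
        (a powr (1 / enn2real p)) powr enn2real p \<le> K powr enn2real p"
      using r assms by (metis powr_mono2 powr_less_mono2 linorder_not_le powr_ge_zero less_imp_le)
    then show ?thesis using r real by (simp add: powr_powr)
  qed
  then show ?thesis
    using assms real by (auto simp: Lp_norm_def Lp_int_def[symmetric] Let_def)
next
  case top
  then show ?thesis using assms
    by (auto simp: Lp_norm_def Lp_int_def[symmetric] Let_def top_unique)
qed

lemma Lp_norm_finite_iff:
  assumes "p < \<infinity>"
  shows "Lp_norm p f < \<infinity> \<longleftrightarrow> Lp_int (enn2real p) f < \<infinity>"
  using assms by (auto simp: Lp_norm_def Lp_int_def[symmetric] Let_def less_top)

lemma mem_Lp_iff:
  assumes "p < \<infinity>"
  shows "f \<in> Lp p \<longleftrightarrow> f \<in> borel_measurable lebesgue \<and> Lp_int (enn2real p) f < \<infinity>"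
  using Lp_norm_finite_iff[OF assms] by (auto simp: Lp_def)

text \<open>By density, below every positive extended real there is a positive finite one, so
  nonstrict bounds by positive reals suffice. This is the form of bound that
  \<open>Lp_norm_le_iff\<close> handles.\<close>

lemma tendsto_zero_ennreal_iff:
  fixes a :: "nat \<Rightarrow> ennreal"
  shows "a \<longlonglongrightarrow> 0 \<longleftrightarrow> (\<forall>\<epsilon>>0. \<forall>\<^sub>F k in sequentially. a k \<le> ennreal \<epsilon>)"
proof
  assume a: "a \<longlonglongrightarrow> 0"
  show "\<forall>\<epsilon>>0. \<forall>\<^sub>F k in sequentially. a k \<le> ennreal \<epsilon>"
  proof safe
    fix \<epsilon> :: real assume "0 < \<epsilon>"
    then have "\<forall>\<^sub>F k in sequentially. a k < ennreal \<epsilon>"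
      by (intro order_tendstoD(2)[OF a]) simp
    then show "\<forall>\<^sub>F k in sequentially. a k \<le> ennreal \<epsilon>"
      by (auto elim!: eventually_mono)
  qed
next
  assume *: "\<forall>\<epsilon>>0. \<forall>\<^sub>F k in sequentially. a k \<le> ennreal \<epsilon>"
  show "a \<longlonglongrightarrow> 0"
  proof (rule order_tendstoI)
    fix y :: ennreal assume "0 < y"
    then obtain z where z: "0 < z" "z < y" using dense by blast
    then obtain d where d: "z = ennreal d" "0 < d"
      by (cases z) (auto simp: top_unique)
    show "\<forall>\<^sub>F k in sequentially. a k < y"
      using *[rule_format, OF d(2)] z d by (auto elim!: eventually_mono)
  qed auto
qed

text \<open>The thresholds on the two sides correspond through the power \<open>r\<close> and the
  root \<open>1 / r\<close>.\<close>

lemma Lp_norm_tendsto_zero_iff: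
  assumes "0 < p" "p < \<infinity>"
  shows "(\<lambda>k. Lp_norm p (F k)) \<longlonglongrightarrow> 0 \<longleftrightarrow> (\<lambda>k. Lp_int (enn2real p) (F k)) \<longlonglongrightarrow> 0"
proof -
  let ?r = "enn2real p"
  have r: "0 < ?r" using assms by (simp add: enn2real_exponent_pos)
  show ?thesis
    unfolding tendsto_zero_ennreal_iff
  proof safe
    fix \<epsilon> :: real assume *: "\<forall>\<epsilon>>0. \<forall>\<^sub>F k in sequentially. Lp_norm p (F k) \<le> ennreal \<epsilon>" "0 < \<epsilon>"
    then have "\<forall>\<^sub>F k in sequentially. Lp_norm p (F k) \<le> ennreal (\<epsilon> powr (1 / ?r))"
      by auto
    then show "\<forall>\<^sub>F k in sequentially. Lp_int ?r (F k) \<le> ennreal \<epsilon>"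
      using r *(2) by (simp add: powr_powr Lp_norm_le_iff[OF assms])
  next
    fix \<epsilon> :: real assume *: "\<forall>\<epsilon>>0. \<forall>\<^sub>F k in sequentially. Lp_int ?r (F k) \<le> ennreal \<epsilon>" "0 < \<epsilon>"
    then have "\<forall>\<^sub>F k in sequentially. Lp_int ?r (F k) \<le> ennreal (\<epsilon> powr ?r)"
      by auto
    then show "\<forall>\<^sub>F k in sequentially. Lp_norm p (F k) \<le> ennreal \<epsilon>"
      using *(2) by (simp add: Lp_norm_le_iff[OF assms])
  qed
qed

lemma tendsto_zero_add_ennreal:
  fixes a b :: "nat \<Rightarrow> ennreal"
  assumes "a \<longlonglongrightarrow> 0" "b \<longlonglongrightarrow> 0"
  shows "(\<lambda>k. a k + b k) \<longlonglongrightarrow> 0"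
  using tendsto_add[OF assms] by simp

section \<open>Completeness for all finite positive exponents\<close>

text \<open>A Riesz-Fischer argument that avoids Minkowski's inequality. Integrating a weighted
  series of \<open>r\<close>-th powers of the increments shows that they decay geometrically almost
  everywhere; Fatou's lemma then turns the pointwise limit into a limit of integrals.\<close>

lemma Lp_int_rapid_Cauchy_converges:
  fixes F :: "nat \<Rightarrow> 'n::finite cfun"
  assumes [measurable]: "\<And>n. F n \<in> borel_measurable lebesgue" and "0 < r"
    and rapid: "\<And>n i j. n < i \<Longrightarrow> n < j \<Longrightarrow> Lp_int r (\<lambda>x. F i x - F j x) \<le> ennreal ((1/4)^n)"
  shows "\<exists>h \<in> borel_measurable lebesgue. (\<lambda>n. Lp_int r (\<lambda>x. F n x - h x)) \<longlonglongrightarrow> 0"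
proof -
  \<comment> \<open>The indices \<open>n + 1\<close> and \<open>n + 2\<close> are the first two that
    \<open>rapid\<close> controls by \<open>(1/4)^n\<close>.\<close>
  define d where "d n x = F (n + 2) x - F (n + 1) x" for n x
  have [measurable]: "d n \<in> borel_measurable lebesgue" for n
    unfolding d_def by measurable
  \<comment> \<open>The weight \<open>2^n\<close> still leaves a summable bound
    \<open>(1/2)^n\<close>, and finiteness of the weighted sum forces geometric decay of the single
    terms.\<close>
  let ?S = "\<lambda>x. \<Sum>n. ennreal (2^n) * ennreal (cmod (d n x) powr r)"
  have "(\<integral>\<^sup>+ x. ?S x \<partial>lebesgue) = (\<Sum>n. ennreal (2^n) * Lp_int r (d n))"
    by (simp add: nn_integral_suminf nn_integral_cmult Lp_int_def)
  also have "\<dots> \<le> (\<Sum>n. ennreal ((1/2)^n))"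
  proof (intro suminf_le)
    fix n
    have "ennreal (2^n) * Lp_int r (d n) \<le> ennreal (2^n) * ennreal ((1/4)^n)"
      unfolding d_def by (intro mult_left_mono rapid) auto
    also have "\<dots> = ennreal ((1/2)^n)"
      by (simp flip: ennreal_mult power_mult_distrib)
    finally show "ennreal (2^n) * Lp_int r (d n) \<le> ennreal ((1/2)^n)" .
  qed auto
  also have "\<dots> < \<infinity>"
    by (subst suminf_ennreal2) auto
  finally have "(\<integral>\<^sup>+ x. ?S x \<partial>lebesgue) \<noteq> \<infinity>" by simp
  then have "AE x in lebesgue. ?S x \<noteq> \<infinity>"
    by (intro nn_integral_PInf_AE) auto
  then have conv: "AE x in lebesgue. convergent (\<lambda>n. F n x)"
  proof eventually_elim
    case (elim x)
    then obtain s where s: "?S x = ennreal s" "0 \<le> s" by (cases "?S x") auto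
    \<comment> \<open>A single term is at most the whole sum \<open>s\<close>; taking the
      \<open>r\<close>-th root gives a geometric sequence of ratio \<open>(1/2) powr (1/r)\<close>,
      which is below 1.\<close>
    have bound: "cmod (d n x) \<le> s powr (1/r) * ((1/2) powr (1/r))^n" for n
    proof -
      have "ennreal (2^n) * ennreal (cmod (d n x) powr r) \<le> ?S x"
        using sum_le_suminf[of "\<lambda>n. ennreal (2^n) * ennreal (cmod (d n x) powr r)" "{n}"] by simp
      then have "2^n * cmod (d n x) powr r \<le> s"
        using s by (simp flip: ennreal_mult)
      then have "cmod (d n x) powr r \<le> s * (1/2)^n"
        by (simp add: field_simps power_one_over)
      then have "(cmod (d n x) powr r) powr (1/r) \<le> (s * (1/2)^n) powr (1/r)"
        using \<open>0 < r\<close> by (intro powr_mono2) auto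
      then show ?thesis
        using \<open>0 < r\<close> s by (simp add: powr_powr powr_mult powr_power powr_realpow[symmetric] mult.commute)
    qed
    have "(1/2::real) powr (1/r) < 1"
      using \<open>0 < r\<close> powr_less_mono2[of "1/r" "1/2" 1] by simp
    then have "summable (\<lambda>n. s powr (1/r) * ((1/2) powr (1/r))^n)"
      by (intro summable_mult summable_geometric) auto
    then have "summable (\<lambda>n. d n x)"
      by (rule summable_comparison_test') (use bound in auto)
    then have "convergent (\<lambda>n. \<Sum>k<n. d k x)"
      by (simp add: summable_iff_convergent)
    moreover have "(\<Sum>k<n. d k x) = F (n + 1) x - F 1 x" for n
      using sum_lessThan_telescope[of "\<lambda>k. F (k + 1) x" n] by (simp add: d_def)
    ultimately have "convergent (\<lambda>n. F (n + 1) x - F 1 x)" by simp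
    then have "convergent (\<lambda>n. F (Suc n) x)"
      using convergent_diff_const_right_iff[of "\<lambda>n. F (n + 1) x" "F 1 x"] by simp
    then show ?case unfolding convergent_def by (subst (asm) filterlim_sequentially_Suc)
  qed
  \<comment> \<open>Where the sequence diverges, \<open>lim\<close> has an unspecified value; this
    happens only on a null set.\<close>
  define h where "h x = lim (\<lambda>n. F n x)" for x
  have [measurable]: "h \<in> borel_measurable lebesgue" unfolding h_def by measurable
  \<comment> \<open>Fatou's lemma in \<open>j\<close>, with \<open>i\<close> fixed:
    \<open>F i - h\<close> is the limit of \<open>F i - F j\<close> almost everywhere.\<close>
  have bound: "Lp_int r (\<lambda>x. F i x - h x) \<le> ennreal ((1/4)^n)" if "n < i" for i n
  proof -
    have "AE x in lebesgue. ennreal (cmod (F i x - h x) powr r) =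
        liminf (\<lambda>j. ennreal (cmod (F i x - F j x) powr r))"
      using conv
    proof eventually_elim
      case (elim x)
      then have "(\<lambda>j. F j x) \<longlonglongrightarrow> h x"
        by (simp add: h_def convergent_LIMSEQ_iff)
      then have "(\<lambda>j. ennreal (cmod (F i x - F j x) powr r)) \<longlonglongrightarrow> ennreal (cmod (F i x - h x) powr r)"
        using \<open>0 < r\<close> by (intro tendsto_ennrealI tendsto_powr' tendsto_intros) auto
      then show ?case by (intro lim_imp_Liminf[symmetric]) auto
    qed
    then have "Lp_int r (\<lambda>x. F i x - h x) =
        (\<integral>\<^sup>+ x. liminf (\<lambda>j. ennreal (cmod (F i x - F j x) powr r)) \<partial>lebesgue)"
      unfolding Lp_int_def by (rule nn_integral_cong_AE)
    also have "\<dots> \<le> liminf (\<lambda>j. Lp_int r (\<lambda>x. F i x - F j x))"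
      unfolding Lp_int_def by (rule nn_integral_liminf) auto
    also have "\<dots> \<le> ennreal ((1/4)^n)"
      by (rule Liminf_le)
        (use rapid[OF that] in \<open>auto simp: eventually_sequentially intro!: exI[of _ "Suc n"]\<close>)
    finally show ?thesis .
  qed
  have "(\<lambda>n. ennreal ((1/4)^n)) \<longlonglongrightarrow> ennreal 0"
    by (intro tendsto_ennrealI LIMSEQ_realpow_zero) auto
  then have "(\<lambda>n. ennreal ((1/4)^n)) \<longlonglongrightarrow> 0" by simp
  then have "(\<lambda>n. Lp_int r (\<lambda>x. F (Suc n) x - h x)) \<longlonglongrightarrow> 0"
    by (rule tendsto_sandwich[OF _ _ tendsto_const, rotated 2]) (simp_all add: bound[OF lessI])
  then have "(\<lambda>n. Lp_int r (\<lambda>x. F n x - h x)) \<longlonglongrightarrow> 0"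
    by (subst (asm) filterlim_sequentially_Suc)
  then show ?thesis by (intro bexI[of _ h]) auto
qed

subsection \<open>Norm limits of compact operators\<close>

lemma Lp_borel: "g \<in> Lp p \<Longrightarrow> g \<in> borel_measurable lebesgue"
  by (simp add: Lp_def)

text \<open>Some \<open>F k\<close> is at finite distance from \<open>h\<close>, and the
  quasi-triangle inequality transfers finiteness. It supplies the membership of the limit in
  \<open>Lp q\<close> that \<open>compact_operators\<close> demands.\<close>

lemma Lp_limit:
  fixes F :: "nat \<Rightarrow> 'n::finite cfun"
  assumes q: "0 < q" "q < \<infinity>" and F: "\<And>k. F k \<in> Lp q"
    and h [measurable]: "h \<in> borel_measurable lebesgue"
    and lim: "(\<lambda>k. Lp_int (enn2real q) (\<lambda>x. F k x - h x)) \<longlonglongrightarrow> 0"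
  shows "h \<in> Lp q"
proof -
  let ?r = "enn2real q"
  have r: "0 < ?r" using q by (simp add: enn2real_exponent_pos)
  obtain k where k: "Lp_int ?r (\<lambda>x. F k x - h x) \<le> ennreal 1"
    using lim[unfolded tendsto_zero_ennreal_iff, rule_format, of 1]
    by (auto simp del: ennreal_1 simp: eventually_sequentially)
  note [measurable] = Lp_borel[OF F]
  have "Lp_int ?r (\<lambda>x. h x - 0) \<le>
      ennreal (2 powr ?r) * (Lp_int ?r (\<lambda>x. h x - F k x) + Lp_int ?r (\<lambda>x. F k x - 0))"
    by (rule Lp_int_triangle) (use r in auto)
  also have "\<dots> < \<infinity>"
  proof -
    have "Lp_int ?r (F k) < \<infinity>" using F[of k] mem_Lp_iff[OF q(2)] by blast
    moreover have "Lp_int ?r (\<lambda>x. h x - F k x) < \<infinity>"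
      unfolding Lp_int_minus_commute[of _ h] by (rule le_less_trans[OF k]) simp
    ultimately show ?thesis by (auto simp: ennreal_mult_less_top)
  qed
  finally show ?thesis by (simp add: mem_Lp_iff[OF q(2)])
qed

lemma Lp_scale:
  assumes "p < \<infinity>" "f \<in> Lp p"
  shows "(\<lambda>x. c * f x) \<in> Lp p"
  using assms by (auto simp: mem_Lp_iff Lp_int_scale ennreal_mult_less_top)

lemma Lp_norm_cong_AE:
  assumes "p < \<infinity>" "AE x in lebesgue. f x = g x"
  shows "Lp_norm p f = Lp_norm p g"
  using Lp_int_cong_AE[OF assms(2), of "enn2real p"] assms(1)
  by (auto simp: Lp_norm_def Lp_int_def)

section \<open>Bounded operators and their quasi-norms\<close>

lemma op_norm_cong_AE:
  assumes "q < \<infinity>" "\<And>g. g \<in> Lp p \<Longrightarrow> AE x in lebesgue. A g x = B g x"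
  shows "op_norm p q A = op_norm p q B"
  unfolding op_norm_def using assms by (intro SUP_cong refl Lp_norm_cong_AE) auto

lemma linear_AE_onD:
  assumes "linear_AE_on V A"
  shows linear_AE_on_borel: "g \<in> V \<Longrightarrow> A g \<in> borel_measurable lebesgue"
    and linear_AE_on_cong:
      "g \<in> V \<Longrightarrow> h \<in> V \<Longrightarrow> AE x in lebesgue. g x = h x \<Longrightarrow> AE x in lebesgue. A g x = A h x"
    and linear_AE_on_add:
      "g \<in> V \<Longrightarrow> h \<in> V \<Longrightarrow> AE x in lebesgue. A (\<lambda>y. g y + h y) x = A g x + A h x"
    and linear_AE_on_scale: "g \<in> V \<Longrightarrow> AE x in lebesgue. A (\<lambda>y. c * g y) x = c * A g x"
  using assms by (simp_all add: linear_AE_on_def)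

text \<open>Homogeneity: \<open>g / M\<close> lies in the unit ball over which
  \<open>op_norm\<close> takes its supremum. A positive upper bound \<open>M\<close> in place of the
  norm of \<open>g\<close> covers functions of norm zero without a separate case.\<close>

lemma Lp_norm_image_le:
  fixes A :: "'n::finite cfun \<Rightarrow> 'n cfun"
  assumes A: "linear_AE_on (Lp p) A" and p: "0 < p" "p < \<infinity>" and q: "0 < q" "q < \<infinity>"
    and K: "op_norm p q A \<le> ennreal K" "0 \<le> K"
    and g: "g \<in> Lp p" "Lp_norm p g \<le> ennreal M" and "0 < M"
  shows "Lp_norm q (A g) \<le> ennreal (K * M)"
proof -
  note [measurable] = Lp_borel[OF g(1)]
  let ?g = "\<lambda>x. complex_of_real (1 / M) * g x"
  have g': "?g \<in> Lp p" using Lp_scale[OF p(2) g(1)] .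
  have [measurable]: "A g \<in> borel_measurable lebesgue"
    using A g(1) by (auto simp: linear_AE_on_def)
  have "Lp_int (enn2real p) ?g \<le> ennreal ((1 / M) powr enn2real p) * ennreal (M powr enn2real p)"
    using g(2) \<open>0 < M\<close>
    by (subst Lp_int_scale) (auto simp: Lp_norm_le_iff[OF p] norm_divide intro!: mult_left_mono)
  also have "\<dots> = ennreal (1 powr enn2real p)"
    using \<open>0 < M\<close> by (simp flip: ennreal_mult powr_mult)
  finally have "Lp_norm p ?g \<le> ennreal 1"
    by (subst Lp_norm_le_iff[OF p]) auto
  then have "Lp_norm q (A ?g) \<le> op_norm p q A"
    unfolding op_norm_def using g' by (intro SUP_upper) auto
  also have "Lp_norm q (A ?g) = Lp_norm q (\<lambda>x. complex_of_real (1 / M) * A g x)"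
    using A g(1) unfolding linear_AE_on_def by (intro Lp_norm_cong_AE[OF q(2)]) blast
  finally have "Lp_norm q (\<lambda>x. complex_of_real (1 / M) * A g x) \<le> ennreal K"
    using K(1) by simp
  then have *: "ennreal ((1 / M) powr enn2real q) * Lp_int (enn2real q) (A g) \<le> ennreal (K powr enn2real q)"
    using \<open>0 < M\<close> K(2) by (subst (asm) Lp_norm_le_iff[OF q])
      (auto simp: Lp_int_scale[where c = "complex_of_real (1 / M)"] norm_divide simp del: of_real_divide)
  have "Lp_int (enn2real q) (A g) =
      ennreal (M powr enn2real q) * (ennreal ((1 / M) powr enn2real q) * Lp_int (enn2real q) (A g))"
    using \<open>0 < M\<close> by (simp flip: ennreal_mult powr_mult mult.assoc)
  also have "\<dots> \<le> ennreal (M powr enn2real q) * ennreal (K powr enn2real q)"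
    using * by (intro mult_left_mono) auto
  also have "\<dots> = ennreal ((K * M) powr enn2real q)"
    using \<open>0 < M\<close> K(2) by (simp add: powr_mult mult.commute flip: ennreal_mult)
  finally show ?thesis
    using \<open>0 < M\<close> K(2) by (simp add: Lp_norm_le_iff[OF q])
qed

lemma bounded_operator_maps_Lp:
  fixes A :: "'n::finite cfun \<Rightarrow> 'n cfun"
  assumes A: "linear_AE_on (Lp p) A" and p: "0 < p" "p < \<infinity>" and q: "0 < q" "q < \<infinity>"
    and K: "op_norm p q A < \<infinity>"
  shows "A ` Lp p \<subseteq> Lp q"
proof safe
  fix g :: "'n cfun" assume g: "g \<in> Lp p"
  obtain k where k: "op_norm p q A = ennreal k" "0 \<le> k" using K by (cases "op_norm p q A") auto
  obtain m where m: "Lp_norm p g = ennreal m" "0 \<le> m"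
    using g unfolding Lp_def by (cases "Lp_norm p g") auto
  \<comment> \<open>Adding 1 makes the bound positive even when \<open>g\<close> has norm
    zero.\<close>
  have "Lp_norm q (A g) \<le> ennreal (k * (m + 1))"
    using k m g by (intro Lp_norm_image_le[OF A p q]) auto
  also have "\<dots> < \<infinity>" by simp
  finally have "Lp_norm q (A g) < \<infinity>" .
  then show "A g \<in> Lp q" using A g by (auto simp: Lp_def linear_AE_on_def)
qed

lemma linear_AE_on_diff:
  fixes A B :: "'n::finite cfun \<Rightarrow> 'n cfun"
  assumes "linear_AE_on V A" "linear_AE_on V B"
  shows "linear_AE_on V (\<lambda>g x. A g x - B g x)"
  unfolding linear_AE_on_def
proof (intro conjI ballI allI impI)
  fix g assume "g \<in> V"
  then show "(\<lambda>x. A g x - B g x) \<in> borel_measurable lebesgue"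
    using assms by (intro borel_measurable_diff linear_AE_on_borel)
next
  fix g h assume "g \<in> V" "h \<in> V" "AE x in lebesgue. g x = h x"
  from linear_AE_on_cong[OF assms(1) this] linear_AE_on_cong[OF assms(2) this]
  show "AE x in lebesgue. A g x - B g x = A h x - B h x" by eventually_elim simp
next
  fix g h assume "g \<in> V" "h \<in> V"
  from linear_AE_on_add[OF assms(1) this] linear_AE_on_add[OF assms(2) this]
  show "AE x in lebesgue. A (\<lambda>y. g y + h y) x - B (\<lambda>y. g y + h y) x = A g x - B g x + (A h x - B h x)"
    by eventually_elim simp
next
  fix c g assume "g \<in> V"
  from linear_AE_on_scale[OF assms(1) this, of c] linear_AE_on_scale[OF assms(2) this, of c]
  show "AE x in lebesgue. A (\<lambda>y. c * g y) x - B (\<lambda>y. c * g y) x = c * (A g x - B g x)"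
    by eventually_elim (simp add: algebra_simps)
qed

text \<open>Compactness of an approximant \<open>B\<close> yields a subsequence whose images under
  \<open>A\<close> are mutually within \<open>(1/4)^n\<close>. A diagonal subsequence achieves this
  for every \<open>n\<close>, hence its images are rapidly Cauchy and converge by
  completeness.\<close>

theorem compact_operators_op_norm_closed:
  fixes A :: "'n::finite cfun \<Rightarrow> 'n cfun"
  assumes p: "0 < p" "p < \<infinity>" and q: "0 < q" "q < \<infinity>"
    and A: "linear_AE_on (Lp p) A" "A ` Lp p \<subseteq> Lp q"
    and approx: "\<And>\<epsilon>. 0 < \<epsilon> \<Longrightarrow>
      \<exists>B \<in> compact_operators p q. op_norm p q (\<lambda>g x. A g x - B g x) \<le> ennreal \<epsilon>"
  shows "A \<in> compact_operators p q"
proof -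
  let ?r = "enn2real q"
  let ?c = "2 powr ?r"
  have r: "0 < ?r" using q by (simp add: enn2real_exponent_pos)
  have "\<exists>h \<in> Lp q. \<exists>\<rho> :: nat \<Rightarrow> nat. strict_mono \<rho> \<and>
      (\<lambda>k. Lp_norm q (\<lambda>x. A (G (\<rho> k)) x - h x)) \<longlonglongrightarrow> 0"
    if G: "range G \<subseteq> Lp p" "\<exists>M<\<infinity>. \<forall>k. Lp_norm p (G k) \<le> M" for G :: "nat \<Rightarrow> 'n cfun"
  proof -
    obtain M' where M': "M' < \<infinity>" "\<And>k. Lp_norm p (G k) \<le> M'" using G(2) by blast
    define M where "M = enn2real M' + 1"
    have M: "0 < M" "Lp_norm p (G k) \<le> ennreal M" for k
    proof -
      show "0 < M" by (simp add: M_def add_nonneg_pos)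
      have "M' \<le> ennreal M" using M'(1) unfolding M_def by (cases M') (auto intro: ennreal_leI)
      with M'(2)[of k] show "Lp_norm p (G k) \<le> ennreal M" by simp
    qed
    have [measurable]: "A (G k) \<in> borel_measurable lebesgue" for k
      using A(1) G(1) by (auto simp: linear_AE_on_def)
    \<comment> \<open>Quantifying over all pairs of indices, not only large ones, makes
      \<open>P n\<close> pass to every subsequence, as the diagonal construction requires.\<close>
    define P where "P n s \<longleftrightarrow>
      (\<forall>i j. Lp_int ?r (\<lambda>x. A (G (s i)) x - A (G (s j)) x) \<le> ennreal ((1/4)^n))"
      for n and s :: "nat \<Rightarrow> nat"
    have P_D: "Lp_int ?r (\<lambda>x. A (G (s i)) x - A (G (s j)) x) \<le> ennreal ((1/4)^n)"
      if "P n s" for n s i j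
      using that by (simp add: P_def)
    interpret subseqs P
    proof
      fix n :: nat and s :: "nat \<Rightarrow> nat" assume s: "strict_mono s"
      \<comment> \<open>Two uses of the quasi-triangle inequality turn \<open>\<delta>\<close> first
        into \<open>2 * ?c * \<delta>\<close> and then into \<open>4 * ?c * ?c * \<delta>\<close>,
        which is \<open>(1/4)^n\<close>.\<close>
      define \<delta> where "\<delta> = (1/4)^n / (4 * ?c * ?c)"
      have \<delta>: "0 < \<delta>" by (simp add: \<delta>_def)
      \<comment> \<open>The root converts \<open>\<delta>\<close> from the integral to the
        quasi-norm; dividing by \<open>M\<close> compensates for the size of the sequence.\<close>
      obtain B where B: "B \<in> compact_operators p q"
        "op_norm p q (\<lambda>g x. A g x - B g x) \<le> ennreal (\<delta> powr (1/?r) / M)"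
        using approx[of "\<delta> powr (1/?r) / M"] \<delta> M(1) by auto
      then have linB: "linear_AE_on (Lp p) B" by (simp add: compact_operators_def)
      have [measurable]: "B (G k) \<in> borel_measurable lebesgue" for k
        using linB G(1) by (auto simp: linear_AE_on_def)
      have "range (G \<circ> s) \<subseteq> Lp p \<and> (\<exists>M<\<infinity>. \<forall>k. Lp_norm p ((G \<circ> s) k) \<le> M)"
        using G by auto
      then obtain h \<rho> where h: "h \<in> Lp q" and \<rho>: "strict_mono (\<rho> :: nat \<Rightarrow> nat)"
        and lim: "(\<lambda>k. Lp_norm q (\<lambda>x. B ((G \<circ> s) (\<rho> k)) x - h x)) \<longlonglongrightarrow> 0"
        using B(1) unfolding compact_operators_def by blast
      note [measurable] = Lp_borel[OF h]
      obtain k0 where k0: "\<And>k. k0 \<le> k \<Longrightarrow> Lp_int ?r (\<lambda>x. B (G (s (\<rho> k))) x - h x) \<le> ennreal \<delta>"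
        using lim \<delta> unfolding Lp_norm_tendsto_zero_iff[OF q] tendsto_zero_ennreal_iff
        by (force simp: eventually_sequentially)
      have AB: "Lp_int ?r (\<lambda>x. A (G k) x - B (G k) x) \<le> ennreal \<delta>" for k
      proof -
        have "Lp_norm q (\<lambda>x. A (G k) x - B (G k) x) \<le> ennreal (\<delta> powr (1/?r) / M * M)"
          using \<delta> M G(1) B(2) linear_AE_on_diff[OF A(1) linB]
          by (intro Lp_norm_image_le[OF _ p q, where A = "\<lambda>g x. A g x - B g x"]) auto
        then show ?thesis using M(1) \<delta> r by (simp add: Lp_norm_le_iff[OF q] powr_powr)
      qed
      have Ah: "Lp_int ?r (\<lambda>x. A (G (s (\<rho> k))) x - h x) \<le> ennreal (2 * ?c * \<delta>)" if "k0 \<le> k" for k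
      proof -
        have "Lp_int ?r (\<lambda>x. A (G (s (\<rho> k))) x - h x) \<le> ennreal ?c * (ennreal \<delta> + ennreal \<delta>)"
          by (rule order_trans[OF Lp_int_triangle[where g = "B (G (s (\<rho> k)))"]])
            (use r AB k0[OF that] in \<open>auto intro!: mult_left_mono add_mono\<close>)
        also have "\<dots> = ennreal (2 * ?c * \<delta>)"
          using \<delta> by (simp flip: ennreal_plus ennreal_mult)
        finally show ?thesis .
      qed
      \<comment> \<open>Discarding the first \<open>k0\<close> terms makes the estimate hold for all
        pairs.\<close>
      let ?r' = "\<lambda>k. \<rho> (k0 + k)"
      have "P n (s \<circ> ?r')" unfolding P_def o_def
      proof safe
        fix i j
        let ?a = "\<lambda>i. A (G (s (\<rho> (k0 + i))))"
        have "Lp_int ?r (\<lambda>x. ?a i x - ?a j x) \<le> ennreal ?c * (ennreal (2 * ?c * \<delta>) + ennreal (2 * ?c * \<delta>))"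
          by (rule order_trans[OF Lp_int_triangle[where g = h]])
            (use r Ah in \<open>auto simp: Lp_int_minus_commute[of _ h] intro!: mult_left_mono add_mono\<close>)
        also have "\<dots> = ennreal ((1/4)^n)"
          using \<delta> by (simp flip: ennreal_plus ennreal_mult) (simp add: \<delta>_def)
        finally show "Lp_int ?r (\<lambda>x. ?a i x - ?a j x) \<le> ennreal ((1/4)^n)" .
      qed
      moreover have "strict_mono ?r'" using \<rho> by (simp add: strict_mono_def)
      ultimately show "\<exists>r'. strict_mono r' \<and> P n (s \<circ> r')" by blast
    qed
    define F where "F k = A (G (diagseq k))" for k
    have [measurable]: "F k \<in> borel_measurable lebesgue" for k
      unfolding F_def by measurable
    have rapid: "Lp_int ?r (\<lambda>x. F i x - F j x) \<le> ennreal ((1/4)^n)" if "n < i" "n < j" for n i j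
    proof -
      \<comment> \<open>From index \<open>Suc n\<close> on, the diagonal sequence is a subsequence
        of one satisfying \<open>P n\<close>; this range is exactly \<open>n < i\<close>.\<close>
      have "P n (diagseq \<circ> ((+) (Suc n)))" by (rule diagseq_holds) (auto simp: P_def)
      from P_D[OF this, of "i - Suc n" "j - Suc n"] show ?thesis
        using that by (simp add: F_def)
    qed
    have "\<exists>h \<in> borel_measurable lebesgue. (\<lambda>n. Lp_int ?r (\<lambda>x. F n x - h x)) \<longlonglongrightarrow> 0"
      by (rule Lp_int_rapid_Cauchy_converges[OF _ r rapid]) measurable
    then obtain h where [measurable]: "h \<in> borel_measurable lebesgue"
      and lim: "(\<lambda>n. Lp_int ?r (\<lambda>x. F n x - h x)) \<longlonglongrightarrow> 0"
      by blast
    have "F k \<in> Lp q" for k using A(2) G(1) unfolding F_def by blast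
    then have "h \<in> Lp q" using Lp_limit[OF q _ _ lim] by simp
    moreover have "(\<lambda>k. Lp_norm q (\<lambda>x. A (G (diagseq k)) x - h x)) \<longlonglongrightarrow> 0"
      using lim unfolding F_def Lp_norm_tendsto_zero_iff[OF q] .
    ultimately show ?thesis using subseq_diagseq by blast
  qed
  then show ?thesis using A unfolding compact_operators_def by blast
qed

subsection \<open>Restriction to a set of finite measure\<close>

text \<open>This splitting replaces Hoelder's inequality on sets of finite measure.\<close>

lemma powr_le_threshold:
  fixes y :: real
  assumes "0 \<le> y" "0 < t" "0 \<le> s" "s \<le> r"
  shows "y powr s \<le> t powr s + t powr (s - r) * y powr r"
proof (cases "y \<le> t")
  case True
  then have "y powr s \<le> t powr s" using assms by (intro powr_mono2) auto
  then show ?thesis by (simp add: add_increasing2)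
next
  case False
  then have "y powr s = y powr (s - r) * y powr r" using assms by (simp flip: powr_add)
  also have "\<dots> \<le> t powr (s - r) * y powr r"
    using False assms by (intro mult_right_mono powr_mono2') auto
  finally show ?thesis by (simp add: add_increasing)
qed

text \<open>Values up to \<open>t\<close> are charged to the measure of \<open>E\<close>, larger
  ones to the integral with exponent \<open>r\<close>. The threshold stays free so that it can be
  chosen before the integral is made small.\<close>

lemma Lp_int_restrict_le:
  assumes [measurable]: "f \<in> borel_measurable lebesgue" "E \<in> sets lebesgue"
    and "0 < t" "0 \<le> s" "s \<le> r"
  shows "Lp_int s (\<lambda>x. if x \<in> E then f x else 0) \<le>
    ennreal (t powr s) * emeasure lebesgue E + ennreal (t powr (s - r)) * Lp_int r f"
proof -
  have "Lp_int s (\<lambda>x. if x \<in> E then f x else 0) \<le>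
      (\<integral>\<^sup>+ x. ennreal (t powr s) * indicator E x +
        ennreal (t powr (s - r)) * ennreal (cmod (f x) powr r) \<partial>lebesgue)"
    unfolding Lp_int_def
    by (intro nn_integral_mono)
      (use assms in \<open>auto simp: powr_le_threshold simp flip: ennreal_plus ennreal_mult\<close>)
  also have "\<dots> = ennreal (t powr s) * emeasure lebesgue E + ennreal (t powr (s - r)) * Lp_int r f"
    unfolding Lp_int_def by (simp add: nn_integral_add nn_integral_cmult)
  finally show ?thesis .
qed

text \<open>For an infinite exponent only the measure term remains, since the values exceed
  \<open>t\<close> at most on a null set.\<close>

lemma Lp_int_restrict_le_esssup:
  fixes f :: "'n::finite cfun"
  assumes [measurable]: "E \<in> sets lebesgue"
    and "Lp_norm \<infinity> f \<le> ennreal t" "0 \<le> t" "0 \<le> s"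
  shows "Lp_int s (\<lambda>x. if x \<in> E then f x else 0) \<le> ennreal (t powr s) * emeasure lebesgue E"
proof -
  have "AE x in lebesgue. ennreal (cmod (f x)) \<le> Lp_norm \<infinity> f"
    unfolding Lp_norm_def by (simp add: esssup_AE)
  then have "AE x in lebesgue. cmod (f x) \<le> t"
  proof eventually_elim
    case (elim x)
    then have "ennreal (cmod (f x)) \<le> ennreal t" using assms(2) by (rule order_trans)
    then show ?case using assms(3) by simp
  qed
  then have "Lp_int s (\<lambda>x. if x \<in> E then f x else 0) \<le>
      (\<integral>\<^sup>+ x. ennreal (t powr s) * indicator E x \<partial>lebesgue)"
    unfolding Lp_int_def
    by (intro nn_integral_mono_AE, eventually_elim)
      (use assms(4) in \<open>auto intro!: ennreal_leI powr_mono2 split: split_indicator\<close>)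
  also have "\<dots> = ennreal (t powr s) * emeasure lebesgue E"
    by (simp add: nn_integral_cmult)
  finally show ?thesis .
qed

text \<open>Continuity at zero of the restriction to \<open>E\<close> from \<open>L^e\<close> to
  \<open>L^q\<close>. The threshold \<open>t\<close> is fixed first, making the measure term small
  for all \<open>k\<close>; convergence then controls the rest.\<close>

lemma Lp_int_restrict_tendsto_zero:
  fixes F :: "nat \<Rightarrow> 'n::finite cfun"
  assumes [measurable]: "E \<in> sets lebesgue" "\<And>k. F k \<in> borel_measurable lebesgue"
    and E: "emeasure lebesgue E < \<infinity>"
    and q: "0 < q" "q < \<infinity>" "q \<le> e"
    and lim: "(\<lambda>k. Lp_norm e (F k)) \<longlonglongrightarrow> 0"
  shows "(\<lambda>k. Lp_int (enn2real q) (\<lambda>x. if x \<in> E then F k x else 0)) \<longlonglongrightarrow> 0"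
  unfolding tendsto_zero_ennreal_iff
proof safe
  fix \<epsilon> :: real assume "0 < \<epsilon>"
  let ?r = "enn2real q"
  have r: "0 < ?r" using q by (simp add: enn2real_exponent_pos)
  obtain m where m: "emeasure lebesgue E = ennreal m" "0 \<le> m"
    using E by (cases "emeasure lebesgue E") auto
  \<comment> \<open>This choice gives \<open>(\<epsilon> / 2) * (m / (m + 1))\<close> for the
    measure term; \<open>m + 1\<close> keeps the denominator positive when \<open>E\<close> is
    null.\<close>
  define t where "t = (\<epsilon> / (2 * (m + 1))) powr (1 / ?r)"
  have t: "0 < t" using \<open>0 < \<epsilon>\<close> m by (simp add: t_def)
  have "t powr ?r * m = (\<epsilon> / 2) * (m / (m + 1))"
    using \<open>0 < \<epsilon>\<close> m r by (simp add: t_def powr_powr field_simps)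
  also have "\<dots> \<le> \<epsilon> / 2"
    using \<open>0 < \<epsilon>\<close> m by (intro mult_left_le) auto
  finally have tm: "ennreal (t powr ?r) * emeasure lebesgue E \<le> ennreal (\<epsilon> / 2)"
    unfolding m(1) by (simp add: m(2) ennreal_leI flip: ennreal_mult)
  show "\<forall>\<^sub>F k in sequentially. Lp_int ?r (\<lambda>x. if x \<in> E then F k x else 0) \<le> ennreal \<epsilon>"
  proof (cases "e = \<infinity>")
    case True
    have "\<forall>\<^sub>F k in sequentially. Lp_norm e (F k) \<le> ennreal t"
      using lim t unfolding tendsto_zero_ennreal_iff by blast
    then show ?thesis
    proof eventually_elim
      case (elim k)
      then have "Lp_int ?r (\<lambda>x. if x \<in> E then F k x else 0) \<le> ennreal (t powr ?r) * emeasure lebesgue E"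
        using t r True by (intro Lp_int_restrict_le_esssup) auto
      also have "\<dots> \<le> ennreal (\<epsilon> / 2)" by (rule tm)
      also have "\<dots> \<le> ennreal \<epsilon>" using \<open>0 < \<epsilon>\<close> by (intro ennreal_leI) auto
      finally show ?case .
    qed
  next
    case False
    then have e: "0 < e" "e < \<infinity>" using q by (auto simp: less_top)
    let ?s = "enn2real e"
    have rs: "?r \<le> ?s" using q e by (intro enn2real_mono) auto
    \<comment> \<open>Chosen so that the second term contributes at most the remaining
      \<open>\<epsilon> / 2\<close>.\<close>
    define \<delta> where "\<delta> = \<epsilon> / (2 * t powr (?r - ?s))"
    have \<delta>: "0 < \<delta>" using \<open>0 < \<epsilon>\<close> t by (simp add: \<delta>_def)
    have "\<forall>\<^sub>F k in sequentially. Lp_int ?s (F k) \<le> ennreal \<delta>"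
      using lim \<delta> unfolding Lp_norm_tendsto_zero_iff[OF e] tendsto_zero_ennreal_iff by blast
    then show ?thesis
    proof eventually_elim
      case (elim k)
      have "Lp_int ?r (\<lambda>x. if x \<in> E then F k x else 0) \<le>
          ennreal (t powr ?r) * emeasure lebesgue E + ennreal (t powr (?r - ?s)) * Lp_int ?s (F k)"
        using t r rs by (intro Lp_int_restrict_le) auto
      also have "\<dots> \<le> ennreal (\<epsilon> / 2) + ennreal (t powr (?r - ?s)) * ennreal \<delta>"
        using tm elim by (intro add_mono mult_left_mono) auto
      also have "\<dots> = ennreal \<epsilon>"
        using t \<open>0 < \<epsilon>\<close> \<delta> by (simp flip: ennreal_plus ennreal_mult) (simp add: \<delta>_def)
      finally show ?case .
    qed
  qed
qed

text \<open>For boundedness the threshold 1 is enough: the measure of \<open>E\<close> plus a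
  uniform bound for the integrals with exponent \<open>p\<close> serves for all
  \<open>k\<close>.\<close>

lemma bounded_Lp_restrict:
  fixes G :: "nat \<Rightarrow> 'n::finite cfun"
  assumes E [measurable]: "E \<in> sets lebesgue" and fin: "emeasure lebesgue E < \<infinity>"
    and u: "0 < u" "u \<le> p" "p < \<infinity>"
    and G: "range G \<subseteq> Lp p" "\<exists>M<\<infinity>. \<forall>k. Lp_norm p (G k) \<le> M"
  shows "range (\<lambda>k x. if x \<in> E then G k x else 0) \<subseteq> Lp u"
    and "\<exists>M<\<infinity>. \<forall>k. Lp_norm u (\<lambda>x. if x \<in> E then G k x else 0) \<le> M"
proof -
  have p: "0 < p" "p < \<infinity>" and u': "u < \<infinity>" using u by auto
  have r: "0 < enn2real u" "enn2real u \<le> enn2real p"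
    using u by (auto simp: enn2real_exponent_pos u' intro!: enn2real_mono)
  have Gb [measurable]: "G k \<in> borel_measurable lebesgue" for k using G(1) Lp_borel by blast
  obtain M where M: "M < \<infinity>" "\<And>k. Lp_norm p (G k) \<le> M" using G(2) by blast
  then obtain m where m: "M = ennreal m" "0 \<le> m" by (cases M) auto
  define c where "c = emeasure lebesgue E + ennreal (m powr enn2real p)"
  have "c < \<infinity>" using fin by (simp add: c_def)
  then obtain d where d: "c = ennreal d" "0 \<le> d" by (cases c) auto
  have le: "Lp_int (enn2real u) (\<lambda>x. if x \<in> E then G k x else 0) \<le> c" for k
  proof -
    have "Lp_int (enn2real u) (\<lambda>x. if x \<in> E then G k x else 0) \<le>
        ennreal (1 powr enn2real u) * emeasure lebesgue E +
        ennreal (1 powr (enn2real u - enn2real p)) * Lp_int (enn2real p) (G k)"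
      using r by (intro Lp_int_restrict_le) auto
    also have "\<dots> \<le> c"
      using M(2)[of k] m unfolding c_def by (auto simp: Lp_norm_le_iff[OF p] intro!: add_mono)
    finally show ?thesis .
  qed
  show "range (\<lambda>k x. if x \<in> E then G k x else 0) \<subseteq> Lp u"
    using le_less_trans[OF le \<open>c < \<infinity>\<close>] by (auto simp: mem_Lp_iff[OF u'])
  have "Lp_norm u (\<lambda>x. if x \<in> E then G k x else 0) \<le> ennreal (d powr (1 / enn2real u))" for k
    using le[of k] d r by (simp add: Lp_norm_le_iff[OF u(1) u'] powr_powr)
  then show "\<exists>M<\<infinity>. \<forall>k. Lp_norm u (\<lambda>x. if x \<in> E then G k x else 0) \<le> M"
    by (intro exI[of _ "ennreal (d powr (1 / enn2real u))"]) auto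
qed

subsection \<open>Commutators\<close>

text \<open>Multiplication by \<open>b\<close> is linear pointwise, so linearity is inherited from
  \<open>T\<close> wherever both \<open>T g\<close> and \<open>T (b g)\<close> are
  meaningful.\<close>

lemma linear_AE_on_commutator:
  fixes b :: "'n::finite cfun"
  assumes T: "linear_operator D T" and [measurable]: "b \<in> borel_measurable lebesgue"
    and V: "V \<subseteq> commutator_dom b D"
  shows "linear_AE_on V (commutator b T)"
proof -
  have lin: "linear_AE_on D T" using T by (simp add: linear_operator_def)
  have D: "g \<in> D" "(\<lambda>x. b x * g x) \<in> D" if "g \<in> V" for g
    using V that by (auto simp: commutator_dom_def)
  show ?thesis
    unfolding linear_AE_on_def
  proof (intro conjI ballI allI impI)
    fix g assume "g \<in> V"
    note [measurable] = linear_AE_on_borel[OF lin D(1)[OF this]] linear_AE_on_borel[OF lin D(2)[OF this]]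
    show "commutator b T g \<in> borel_measurable lebesgue" unfolding commutator_def by measurable
  next
    fix g h assume gh: "g \<in> V" "h \<in> V" "AE x in lebesgue. g x = h x"
    have "AE x in lebesgue. T g x = T h x"
      by (rule linear_AE_on_cong[OF lin]) (use gh D in auto)
    moreover have "AE x in lebesgue. T (\<lambda>y. b y * g y) x = T (\<lambda>y. b y * h y) x"
      by (rule linear_AE_on_cong[OF lin]) (use gh D in auto)
    ultimately show "AE x in lebesgue. commutator b T g x = commutator b T h x"
      unfolding commutator_def by eventually_elim simp
  next
    fix g h assume gh: "g \<in> V" "h \<in> V"
    from linear_AE_on_add[OF lin D(1)[OF gh(1)] D(1)[OF gh(2)]]
      linear_AE_on_add[OF lin D(2)[OF gh(1)] D(2)[OF gh(2)]]
    show "AE x in lebesgue. commutator b T (\<lambda>y. g y + h y) x = commutator b T g x + commutator b T h x"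
      unfolding commutator_def by eventually_elim (simp add: algebra_simps)
  next
    fix c g assume g: "g \<in> V"
    from linear_AE_on_scale[OF lin D(1)[OF g], of c] linear_AE_on_scale[OF lin D(2)[OF g], of c]
    show "AE x in lebesgue. commutator b T (\<lambda>y. c * g y) x = c * commutator b T g x"
      unfolding commutator_def by eventually_elim (simp add: algebra_simps)
  qed
qed

text \<open>Linearity of \<open>T\<close> splits \<open>T ((b - f) g)\<close>, though only almost
  everywhere. This lets the bound in terms of the seminorm of \<open>b - f\<close> control the
  difference of the commutators.\<close>

lemma commutator_diff_AE:
  assumes T: "linear_operator D T" and g: "g \<in> commutator_dom b D" "g \<in> commutator_dom f D"
  shows "AE x in lebesgue.
    commutator (\<lambda>x. b x - f x) T g x = commutator b T g x - commutator f T g x"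
proof -
  have lin: "linear_AE_on D T" and sub: "cfun_subspace D"
    using T by (auto simp: linear_operator_def)
  have b: "(\<lambda>x. b x * g x) \<in> D" and f: "(\<lambda>x. f x * g x) \<in> D"
    using g by (auto simp: commutator_dom_def)
  have f': "(\<lambda>x. - 1 * (f x * g x)) \<in> D" using sub f by (simp only: cfun_subspace_def)
  from linear_AE_on_add[OF lin b f'] linear_AE_on_scale[OF lin f, of "- 1"]
  show ?thesis
    unfolding commutator_def by eventually_elim (simp add: algebra_simps)
qed

text \<open>The factor \<open>f x\<close> removes the first term on both sides, and cutting
  \<open>g\<close> off outside the support leaves the product \<open>f g\<close> the same function,
  so the identity is pointwise. The support is the set where \<open>f\<close> does not vanish,
  without closure.\<close>

lemma commutator_eq_restrict_off_support:
  assumes "x \<notin> support_on UNIV f"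
  shows "commutator f T g x = commutator f T (\<lambda>y. if y \<in> support_on UNIV f then g y else 0) x"
proof -
  have "(\<lambda>y. f y * (if y \<in> support_on UNIV f then g y else 0)) = (\<lambda>y. f y * g y)"
    by (auto simp: support_on_def)
  moreover have "f x = 0" using assms by (simp add: support_on_def)
  ultimately show ?thesis by (simp add: commutator_def)
qed

text \<open>Two successive extractions: compactness into \<open>L^e\<close> gives a limit
  \<open>h1\<close> that is good on the support, and compactness from \<open>L^u\<close>, applied to
  the restricted functions, gives a limit \<open>h2\<close> that is good off it.\<close>

lemma commutator_compact_of_finite_support:
  fixes f :: "'n::finite cfun"
  assumes T: "linear_operator D T" and f [measurable]: "f \<in> borel_measurable lebesgue"
    and fin: "emeasure lebesgue (support_on UNIV f) < \<infinity>"
    and p: "0 < p" "p < \<infinity>" and q: "0 < q" "q < \<infinity>" "q \<le> e" and u: "0 < u" "u \<le> p"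
    and dom: "Lp p \<subseteq> commutator_dom f D" and maps: "commutator f T ` Lp p \<subseteq> Lp q"
    and K: "commutator f T \<in> compact_operators p e" "commutator f T \<in> compact_operators u q"
  shows "commutator f T \<in> compact_operators p q"
proof -
  define E where "E = support_on UNIV f"
  let ?A = "commutator f T"
  let ?R = "\<lambda>g x. if x \<in> E then g x else 0"
  let ?r = "enn2real q"
  have E [measurable]: "E \<in> sets lebesgue"
  proof -
    have "{x \<in> space lebesgue. f x \<noteq> 0} \<in> sets lebesgue" by measurable
    then show ?thesis by (simp add: E_def support_on_def)
  qed
  have lin: "linear_AE_on (Lp p) ?A" by (rule linear_AE_on_commutator[OF T f dom])
  have linu: "linear_AE_on (Lp u) ?A" using K(2) by (simp add: compact_operators_def)
  have "\<exists>h \<in> Lp q. \<exists>\<rho> :: nat \<Rightarrow> nat. strict_mono \<rho> \<and>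
      (\<lambda>k. Lp_norm q (\<lambda>x. ?A (G (\<rho> k)) x - h x)) \<longlonglongrightarrow> 0"
    if G: "range G \<subseteq> Lp p" "\<exists>M<\<infinity>. \<forall>k. Lp_norm p (G k) \<le> M" for G :: "nat \<Rightarrow> 'n cfun"
  proof -
    obtain h1 \<rho>1 where h1: "h1 \<in> Lp e" and \<rho>1: "strict_mono (\<rho>1 :: nat \<Rightarrow> nat)"
      and lim1: "(\<lambda>k. Lp_norm e (\<lambda>x. ?A (G (\<rho>1 k)) x - h1 x)) \<longlonglongrightarrow> 0"
      using K(1) G unfolding compact_operators_def by blast
    have "range (\<lambda>k. G (\<rho>1 k)) \<subseteq> Lp p" "\<exists>M<\<infinity>. \<forall>k. Lp_norm p (G (\<rho>1 k)) \<le> M"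
      using G by auto
    note RG = bounded_Lp_restrict[OF E fin[folded E_def] u p(2) this]
    obtain h2 \<rho>2 where h2: "h2 \<in> Lp q" and \<rho>2: "strict_mono (\<rho>2 :: nat \<Rightarrow> nat)"
      and lim2: "(\<lambda>k. Lp_norm q (\<lambda>x. ?A (?R (G (\<rho>1 (\<rho>2 k)))) x - h2 x)) \<longlonglongrightarrow> 0"
      using K(2) RG unfolding compact_operators_def by blast
    define \<rho> where "\<rho> = \<rho>1 \<circ> \<rho>2"
    have \<rho>: "strict_mono \<rho>" unfolding \<rho>_def using \<rho>1 \<rho>2 by (rule strict_mono_o)
    have Gp: "G k \<in> Lp p" for k using G(1) by blast
    have RGu: "?R (G (\<rho> k)) \<in> Lp u" for k
    proof -
      have "(\<lambda>k x. if x \<in> E then G (\<rho>1 k) x else 0) (\<rho>2 k) \<in> Lp u" using RG(1) by blast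
      then show ?thesis unfolding \<rho>_def o_apply .
    qed
    note [measurable] = Lp_borel[OF h1] Lp_borel[OF h2]
      linear_AE_on_borel[OF lin Gp] linear_AE_on_borel[OF linu RGu]
    \<comment> \<open>The limit is glued from the two pieces along \<open>E\<close>.\<close>
    define h where "h x = (if x \<in> E then h1 x else h2 x)" for x
    have [measurable]: "h \<in> borel_measurable lebesgue" unfolding h_def by measurable
    \<comment> \<open>On \<open>E\<close> the first integrand is the full error; off
      \<open>E\<close> the second one is, as restricting the argument changes nothing there.
      Integrating the second over all of space only enlarges it and matches
      \<open>lim2\<close>.\<close>
    have le: "Lp_int ?r (\<lambda>x. ?A (G (\<rho> k)) x - h x) \<le>
        Lp_int ?r (?R (\<lambda>x. ?A (G (\<rho> k)) x - h1 x)) + Lp_int ?r (\<lambda>x. ?A (?R (G (\<rho> k))) x - h2 x)" for k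
    proof -
      have off: "?A (G (\<rho> k)) x = ?A (?R (G (\<rho> k))) x" if "x \<notin> E" for x
        using that unfolding E_def by (rule commutator_eq_restrict_off_support)
      have "Lp_int ?r (\<lambda>x. ?A (G (\<rho> k)) x - h x) \<le>
          (\<integral>\<^sup>+ x. ennreal (cmod (?R (\<lambda>x. ?A (G (\<rho> k)) x - h1 x) x) powr ?r) +
            ennreal (cmod (?A (?R (G (\<rho> k))) x - h2 x) powr ?r) \<partial>lebesgue)"
        unfolding Lp_int_def h_def
      proof (intro nn_integral_mono)
        fix x
        show "ennreal (cmod (?A (G (\<rho> k)) x - (if x \<in> E then h1 x else h2 x)) powr ?r) \<le>
          ennreal (cmod (?R (\<lambda>x. ?A (G (\<rho> k)) x - h1 x) x) powr ?r) +
            ennreal (cmod (?A (?R (G (\<rho> k))) x - h2 x) powr ?r)"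
          by (cases "x \<in> E") (simp_all add: off)
      qed
      also have "\<dots> = Lp_int ?r (?R (\<lambda>x. ?A (G (\<rho> k)) x - h1 x)) +
          Lp_int ?r (\<lambda>x. ?A (?R (G (\<rho> k))) x - h2 x)"
        unfolding Lp_int_def by (intro nn_integral_add) measurable
      finally show ?thesis .
    qed
    have "(\<lambda>k. Lp_norm e (\<lambda>x. ?A (G (\<rho> k)) x - h1 x)) \<longlonglongrightarrow> 0"
      using LIMSEQ_subseq_LIMSEQ[OF lim1 \<rho>2] by (simp add: o_def \<rho>_def)
    then have "(\<lambda>k. Lp_int ?r (?R (\<lambda>x. ?A (G (\<rho> k)) x - h1 x))) \<longlonglongrightarrow> 0"
      by (intro Lp_int_restrict_tendsto_zero[OF E _ fin[folded E_def] q]) measurable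
    moreover have "(\<lambda>k. Lp_int ?r (\<lambda>x. ?A (?R (G (\<rho> k))) x - h2 x)) \<longlonglongrightarrow> 0"
      using lim2 unfolding Lp_norm_tendsto_zero_iff[OF q(1,2)] \<rho>_def o_apply .
    ultimately have "(\<lambda>k. Lp_int ?r (?R (\<lambda>x. ?A (G (\<rho> k)) x - h1 x)) +
        Lp_int ?r (\<lambda>x. ?A (?R (G (\<rho> k))) x - h2 x)) \<longlonglongrightarrow> 0"
      by (rule tendsto_zero_add_ennreal)
    then have lim: "(\<lambda>k. Lp_int ?r (\<lambda>x. ?A (G (\<rho> k)) x - h x)) \<longlonglongrightarrow> 0"
      by (rule tendsto_sandwich[OF _ _ tendsto_const, rotated 2]) (use le in auto)
    have "?A (G (\<rho> k)) \<in> Lp q" for k using maps Gp by blast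
    then have "h \<in> Lp q" using Lp_limit[OF q(1,2) _ _ lim] by simp
    with \<rho> lim show ?thesis unfolding Lp_norm_tendsto_zero_iff[OF q(1,2), symmetric] by blast
  qed
  then show ?thesis using lin maps unfolding compact_operators_def by blast
qed

section \<open>Commutators with functions in the closure of \<open>Z\<close>\<close>

theorem lemma1p6:
  fixes I :: "(ennreal \<times> ennreal) set"
    and X :: "ennreal \<Rightarrow> ennreal \<Rightarrow> 'n::finite cfun set"
    and N :: "ennreal \<Rightarrow> ennreal \<Rightarrow> 'n cfun \<Rightarrow> real"
    and Z :: "'n cfun set"
    and p q e u C :: ennreal
    and D :: "'n cfun set"
    and T :: "'n cfun \<Rightarrow> 'n cfun"
  assumes "\<forall>(s, t) \<in> I. seminormed_cfun_space (X s t) (N s t)"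
    and "Z \<subseteq> (\<Inter>(s, t) \<in> I. X s t)"
    and "\<forall>f\<in>Z. emeasure lebesgue (support_on UNIV f) < \<infinity>"
    and "0 < p" "p < \<infinity>" "0 < q" "q < \<infinity>" "(p, q) \<in> I"
    and "linear_operator D T"
    and "C < \<infinity>"
    and "\<forall>f \<in> X p q. Lp p \<subseteq> commutator_dom f D \<and>
           op_norm p q (commutator f T) \<le> C * ennreal (N p q f)"
    and "q \<le> e" "0 < u" "u \<le> p"
    and "\<forall>f\<in>Z. Lp u \<subseteq> commutator_dom f D \<and>
           commutator f T \<in> compact_operators p e \<inter> compact_operators u q"
  shows "\<forall>b \<in> seminorm_closure (X p q) (N p q) Z. commutator b T \<in> compact_operators p q"
proof
  fix b assume b: "b \<in> seminorm_closure (X p q) (N p q) Z"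
  note p = \<open>0 < p\<close> \<open>p < \<infinity>\<close> and q = \<open>0 < q\<close> \<open>q < \<infinity>\<close> and T = \<open>linear_operator D T\<close>
  have X: "cfun_subspace (X p q)"
    using assms(1) \<open>(p, q) \<in> I\<close> by (auto simp: seminormed_cfun_space_def)
  have ZX: "f \<in> X p q" if "f \<in> Z" for f using assms(2) \<open>(p, q) \<in> I\<close> that by blast
  have dom: "Lp p \<subseteq> commutator_dom f D" if "f \<in> X p q" for f using assms(11) that by blast
  have borel: "f \<in> borel_measurable lebesgue" if "f \<in> X p q" for f
    using X that by (auto simp: cfun_subspace_def)
  have lin: "linear_AE_on (Lp p) (commutator f T)" if "f \<in> X p q" for f
    by (rule linear_AE_on_commutator[OF T borel[OF that] dom[OF that]])
  have bound: "op_norm p q (commutator f T) \<le> C * ennreal (N p q f)" if "f \<in> X p q" for f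
    using assms(11) that by blast
  \<comment> \<open>A finite supremum over the unit ball extends by homogeneity, so the norm bound
    already places all images in \<open>L^q\<close>.\<close>
  have maps: "commutator f T ` Lp p \<subseteq> Lp q" if "f \<in> X p q" for f
  proof (rule bounded_operator_maps_Lp[OF lin[OF that] p q])
    have "C * ennreal (N p q f) < \<infinity>" using \<open>C < \<infinity>\<close> by (simp add: ennreal_mult_less_top)
    then show "op_norm p q (commutator f T) < \<infinity>" using bound[OF that] by (rule le_less_trans[rotated])
  qed
  have bX: "b \<in> X p q" using b by (simp add: seminorm_closure_def)
  obtain c where c: "C = ennreal c" "0 \<le> c" using \<open>C < \<infinity>\<close> by (cases C) auto
  show "commutator b T \<in> compact_operators p q"
  proof (rule compact_operators_op_norm_closed[OF p q lin[OF bX] maps[OF bX]])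
    fix \<epsilon> :: real assume "0 < \<epsilon>"
    \<comment> \<open>The denominator \<open>c + 1\<close> is positive even if \<open>c = 0\<close>,
      and \<open>c / (c + 1)\<close> is at most 1.\<close>
    then have "0 < \<epsilon> / (c + 1)" using c by simp
    then obtain f where f: "f \<in> Z" and Nf: "N p q (\<lambda>x. b x - f x) < \<epsilon> / (c + 1)"
      using b unfolding seminorm_closure_def by blast
    have fX: "f \<in> X p q" by (rule ZX[OF f])
    have "(\<lambda>x. - 1 * f x) \<in> X p q" using X fX by (simp only: cfun_subspace_def)
    then have "(\<lambda>x. b x + - 1 * f x) \<in> X p q" using X bX by (simp only: cfun_subspace_def)
    then have dX: "(\<lambda>x. b x - f x) \<in> X p q" by simp
    \<comment> \<open>The two operators agree on each \<open>g\<close> only almost everywhere, which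
      suffices for equal norms.\<close>
    have "op_norm p q (\<lambda>g x. commutator b T g x - commutator f T g x) =
        op_norm p q (commutator (\<lambda>x. b x - f x) T)"
    proof (rule op_norm_cong_AE[OF q(2)])
      fix g :: "'n cfun" assume "g \<in> Lp p"
      then have "g \<in> commutator_dom b D" "g \<in> commutator_dom f D" using dom bX fX by blast+
      from commutator_diff_AE[OF T this]
      show "AE x in lebesgue. commutator b T g x - commutator f T g x =
          commutator (\<lambda>x. b x - f x) T g x" by eventually_elim simp
    qed
    also have "\<dots> \<le> C * ennreal (N p q (\<lambda>x. b x - f x))" by (rule bound[OF dX])
    also have "\<dots> \<le> C * ennreal (\<epsilon> / (c + 1))"
      using Nf by (intro mult_left_mono ennreal_leI) auto
    also have "\<dots> = ennreal (\<epsilon> * (c / (c + 1)))"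
      using c \<open>0 < \<epsilon>\<close> by (simp add: mult.commute flip: ennreal_mult)
    also have "\<dots> \<le> ennreal \<epsilon>"
      using c \<open>0 < \<epsilon>\<close> by (intro ennreal_leI mult_left_le) auto
    finally have "op_norm p q (\<lambda>g x. commutator b T g x - commutator f T g x) \<le> ennreal \<epsilon>" .
    moreover have "commutator f T \<in> compact_operators p q"
      using assms(3,15) f
      by (intro commutator_compact_of_finite_support[OF T borel[OF fX] _ p q \<open>q \<le> e\<close> \<open>0 < u\<close> \<open>u \<le> p\<close>
            dom[OF fX] maps[OF fX]]) auto
    ultimately show "\<exists>B \<in> compact_operators p q.
        op_norm p q (\<lambda>g x. commutator b T g x - B g x) \<le> ennreal \<epsilon>" by blast
  qed
qed

end
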